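(* Let $a$, $d$ and $k$ be positive integers with $\gcd(a,d)=1$ and $2\le k\le a$. Let $q$ and $r$ be the nonnegative integers with $a-1=q(k-1)+r$ and $0\le r<k-1$. Then \begin{align*} s(a,a+d,\dots,a+(k-1)d) &=\frac{1}{12 q}\biggl(2 a q^3(a+2 r-1)+q^2\bigl(a d(4 a+4 r-5)-d(2 r-1)(r+1)+6 a r\bigr)\\ &\quad -q\bigl(3 d r(r+1)-(a-1)((a-1)(d^2-1)+a d^2)-2 a r(3 d+1)\bigr)\\ &\quad -d(a-r-1)^2\biggr). \end{align*}
   Context: For positive integers $b_1,\dots,b_m$ with $\gcd(b_1,\dots,b_m)=1$, let $\mathrm{NR}(b_1,\dots,b_m)$ denote the (finite) set of positive integers that cannot be written as $x_1b_1+\cdots+x_mb_m$ with nonnegative integers $x_1,\dots,x_m$. The Sylvester sum is $s(b_1,\dots,b_m)=\sum_{n\in \mathrm{NR}(b_1,\dots,b_m)} n$. *)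

theory Defs
  imports Complex_Main
begin

definition nonrepresentable :: "nat list \<Rightarrow> nat set" where
  "nonrepresentable bs =
     {n. n > 0 \<and> \<not> (\<exists>x :: nat \<Rightarrow> nat. n = (\<Sum>i<length bs. x i * bs ! i))}"

(* Meaningful when the entries of bs are positive with gcd 1, so that the set of
   nonrepresentable numbers is finite; sum over an infinite set is 0 by convention. *)
definition sylvester_sum :: "nat list \<Rightarrow> nat" where
  "sylvester_sum bs = \<Sum> (nonrepresentable bs)"

end

theory Submission
  imports Defs "HOL-Number_Theory.Cong"
begin

text \<open>
  With \<open>K = k - 1\<close>, the representable numbers are the \<open>a X + d Y\<close> with \<open>Y \<le> K X\<close>. Hence the least
  representable number in the residue class of \<open>d y\<close> modulo \<open>a\<close>, for \<open>y < a\<close>, is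
  \<open>w y = a \<lceil>y / K\<rceil> + d y\<close>, and the gaps in this class are the smaller members. Summing these
  arithmetic progressions gives
  \<open>s = (\<Sum>y<a. (w y)\<^sup>2) / (2 a) - (\<Sum>y<a. w y) / 2 + (a\<^sup>2 - 1) / 12\<close>,
  and the sums are evaluated on the blocks where \<open>\<lceil>y / K\<rceil>\<close> is constant.
\<close>

text \<open>\<open>X\<close> counts the summands used and \<open>Y\<close> adds up their indices,
  each at most \<open>K\<close>. Conversely, any total \<open>Y <= K * X\<close> can be spread
  greedily over \<open>X\<close> summands.\<close>

lemma representable_arith_prog_iff:
  fixes a d K n :: nat
  shows "(\<exists>x. n = (\<Sum>i<Suc K. x i * (a + i * d))) \<longleftrightarrow> (\<exists>X Y. n = a * X + d * Y \<and> Y \<le> K * X)"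
proof
  assume "\<exists>x. n = (\<Sum>i<Suc K. x i * (a + i * d))"
  then obtain x where x: "n = (\<Sum>i<Suc K. x i * (a + i * d))" by blast
  have "n = a * (\<Sum>i<Suc K. x i) + d * (\<Sum>i<Suc K. i * x i)"
    unfolding x sum_distrib_left sum.distrib [symmetric]
    by (rule sum.cong) (simp_all add: algebra_simps)
  moreover have "(\<Sum>i<Suc K. i * x i) \<le> K * (\<Sum>i<Suc K. x i)"
    unfolding sum_distrib_left by (rule sum_mono) simp
  ultimately show "\<exists>X Y. n = a * X + d * Y \<and> Y \<le> K * X" by blast
next
  have "\<exists>x. a * X + d * Y = (\<Sum>i<Suc K. x i * (a + i * d))" if "Y \<le> K * X" for X Y
    using that
  proof (induction X arbitrary: Y)
    case 0
    then show ?case by (intro exI [of _ "\<lambda>_. 0"]) simp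
  next
    case (Suc X)
    \<comment> \<open>One summand takes the largest index available; what is left is 0 or
      \<open>Y - K\<close>, so it fits into the other \<open>X\<close> summands.\<close>
    define j where "j = min Y K"
    have j: "j < Suc K" "j \<le> Y" by (auto simp: j_def)
    have "Y - j \<le> K * X" using Suc.prems by (auto simp: j_def)
    from Suc.IH [OF this] obtain x
      where x: "a * X + d * (Y - j) = (\<Sum>i<Suc K. x i * (a + i * d))" by blast
    have "(\<Sum>i<Suc K. (x i + (if i = j then 1 else 0)) * (a + i * d))
        = (\<Sum>i<Suc K. x i * (a + i * d) + (if i = j then a + i * d else 0))"
      by (rule sum.cong) (auto simp: algebra_simps)
    also have "\<dots> = (a * X + d * (Y - j)) + (a + j * d)"
      unfolding sum.distrib x using j(1) by (subst sum.delta) auto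
    also have "\<dots> = a * Suc X + d * (Y - j + j)" by (simp only: algebra_simps mult_Suc_right)
    also have "\<dots> = a * Suc X + d * Y" using j by simp
    finally show ?case by metis
  qed
  then show "\<exists>X Y. n = a * X + d * Y \<and> Y \<le> K * X \<Longrightarrow> \<exists>x. n = (\<Sum>i<Suc K. x i * (a + i * d))"
    by blast
qed

text \<open>The ceiling \<open>\<lceil>y / K\<rceil>\<close>, for \<open>K > 0\<close>.\<close>

definition cdiv :: "nat \<Rightarrow> nat \<Rightarrow> nat" where
  "cdiv y K = (y + (K - 1)) div K"

lemma cdiv_le_iff:
  assumes "K > 0"
  shows "cdiv y K \<le> X \<longleftrightarrow> y \<le> K * X"
proof -
  have "cdiv y K \<le> X \<longleftrightarrow> y + (K - 1) < Suc X * K"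
    unfolding cdiv_def using assms by (metis div_less_iff_less_mult less_Suc_eq_le)
  also have "\<dots> \<longleftrightarrow> y \<le> K * X" using assms by (auto simp: algebra_simps)
  finally show ?thesis .
qed

text \<open>The shift by \<open>Suc\<close> fixes the blocks: the ceiling is \<open>q + 1\<close> on
  \<open>q * K + 1, ..., q * K + K\<close>, and \<open>y = 0\<close> stands apart.\<close>

lemma cdiv_block:
  assumes "r < K"
  shows "cdiv (Suc (q * K + r)) K = Suc q"
proof -
  have "Suc (q * K + r) + (K - 1) = r + Suc q * K" using assms by simp
  then show ?thesis unfolding cdiv_def using assms by (simp del: mult_Suc)
qed

text \<open>As \<open>d\<close> is invertible modulo \<open>a\<close>, the class of
  \<open>a * X + d * Y\<close> fixes \<open>Y\<close> modulo \<open>a\<close>. The least such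
  \<open>Y\<close> also permits the least \<open>X\<close>, so both terms are minimal at
  once.\<close>

lemma nonrepresentable_arith_prog:
  fixes a d K :: nat
  assumes "a > 0" "K > 0" "coprime a d"
  defines "w \<equiv> \<lambda>y. a * cdiv y K + d * y"
  shows "inj_on (\<lambda>y. w y mod a) {..<a}"
    and "nonrepresentable (map (\<lambda>i. a + i * d) [0..<Suc K])
           = {n. \<exists>y<a. n < w y \<and> n mod a = w y mod a}"
proof -
  have cancel: "y mod a = y' mod a" if "(d * y) mod a = (d * y') mod a" for y y'
    using that cong_mult_lcancel_nat [of d a y y'] assms(3)
    by (simp add: cong_def coprime_commute)
  have wmod: "w y mod a = (d * y) mod a" for y by (simp add: w_def)
  show inj: "inj_on (\<lambda>y. w y mod a) {..<a}"
  proof (rule inj_onI)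
    fix y y' assume "y \<in> {..<a}" "y' \<in> {..<a}" "w y mod a = w y' mod a"
    then show "y = y'" using cancel [of y y'] by (simp add: wmod)
  qed
  have least: "(\<exists>X Y. n = a * X + d * Y \<and> Y \<le> K * X) \<longleftrightarrow> w y \<le> n"
    if y: "y < a" and n: "n mod a = w y mod a" for n y
  proof
    assume "\<exists>X Y. n = a * X + d * Y \<and> Y \<le> K * X"
    then obtain X Y where XY: "n = a * X + d * Y" "Y \<le> K * X" by blast
    have "Y mod a = y mod a" using n XY cancel [of Y y] by (simp add: wmod)
    then have "y \<le> Y" using y by (metis mod_less mod_less_eq_dividend)
    then have "cdiv y K \<le> X" using XY cdiv_le_iff [OF assms(2)] by simp
    then show "w y \<le> n" unfolding w_def XY using \<open>y \<le> Y\<close> by (simp add: add_mono)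
  next
    assume le: "w y \<le> n"
    then obtain t where "n = w y + a * t" using n by (metis mod_eq_nat1E)
    \<comment> \<open>Adding multiples of \<open>a\<close> only raises \<open>X\<close>, which
      preserves \<open>y <= K * X\<close>.\<close>
    then have "n = a * (cdiv y K + t) + d * y" by (simp add: w_def algebra_simps)
    moreover have "y \<le> K * (cdiv y K + t)"
      using cdiv_le_iff [OF assms(2), of y "cdiv y K + t"] by simp
    ultimately show "\<exists>X Y. n = a * X + d * Y \<and> Y \<le> K * X" by blast
  qed
  have surj: "\<exists>y<a. n mod a = w y mod a" for n
  proof -
    \<comment> \<open>An injective self-map of a finite set is onto, so every residue class has its
      \<open>w y\<close>.\<close>
    have "(\<lambda>y. w y mod a) ` {..<a} = {..<a}"
      by (rule endo_inj_surj) (use inj assms(1) in auto)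
    moreover have "n mod a \<in> {..<a}" using assms(1) by simp
    ultimately show ?thesis by (metis (no_types, lifting) imageE lessThan_iff)
  qed
  have "(\<Sum>i<length (map (\<lambda>i. a + i * d) [0..<Suc K]). x i * map (\<lambda>i. a + i * d) [0..<Suc K] ! i)
      = (\<Sum>i<Suc K. x i * (a + i * d))" for x
    by (rule sum.cong) (simp_all del: upt_Suc)
  then have "nonrepresentable (map (\<lambda>i. a + i * d) [0..<Suc K])
      = {n. n > 0 \<and> \<not> (\<exists>X Y. n = a * X + d * Y \<and> Y \<le> K * X)}"
    unfolding nonrepresentable_def representable_arith_prog_iff [symmetric] by (simp only:)
  also have "\<dots> = {n. \<not> (\<exists>X Y. n = a * X + d * Y \<and> Y \<le> K * X)}"
  proof (intro Collect_cong)
    fix n :: nat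
    \<comment> \<open>Zero lies in neither set: positivity excludes it from the first,
      \<open>X = Y = 0\<close> from the second.\<close>
    have "\<exists>X Y. n = a * X + d * Y \<and> Y \<le> K * X" if "n = 0"
      using that by (intro exI [of _ 0]) simp
    then show "n > 0 \<and> \<not> (\<exists>X Y. n = a * X + d * Y \<and> Y \<le> K * X)
        \<longleftrightarrow> \<not> (\<exists>X Y. n = a * X + d * Y \<and> Y \<le> K * X)"
      by blast
  qed
  also have "\<dots> = {n. \<exists>y<a. n < w y \<and> n mod a = w y mod a}"
  proof (intro Collect_cong iffI)
    fix n assume n: "\<not> (\<exists>X Y. n = a * X + d * Y \<and> Y \<le> K * X)"
    obtain y where y: "y < a" "n mod a = w y mod a" using surj by blast
    then show "\<exists>y<a. n < w y \<and> n mod a = w y mod a" using n least [OF y] by (meson not_le)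
  next
    fix n assume "\<exists>y<a. n < w y \<and> n mod a = w y mod a"
    then obtain y where y: "y < a" "n mod a = w y mod a" "n < w y" by blast
    then show "\<not> (\<exists>X Y. n = a * X + d * Y \<and> Y \<le> K * X)"
      unfolding least [OF y(1,2)] by simp
  qed
  finally show "nonrepresentable (map (\<lambda>i. a + i * d) [0..<Suc K])
           = {n. \<exists>y<a. n < w y \<and> n mod a = w y mod a}" .
qed

lemma real_sum_lessThan: "(\<Sum>i<n. real i) = real n * (real n - 1) / 2"
  by (induction n) (auto simp: field_simps)

lemma real_sum_squares_lessThan:
  "(\<Sum>i<n. real i ^ 2) = real n * (real n - 1) * (2 * real n - 1) / 6"
  by (induction n) (auto simp: field_simps power2_eq_square)

text \<open>The Brauer--Shockley--Tripathi formula for the gaps below an Apery set \<open>w\<close> of \<open>a\<close>.\<close>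

lemma sum_below_Apery:
  fixes w :: "nat \<Rightarrow> nat"
  assumes a: "a > 0" and inj: "inj_on (\<lambda>y. w y mod a) {..<a}"
  shows "real (\<Sum>{n. \<exists>y<a. n < w y \<and> n mod a = w y mod a})
    = (\<Sum>y<a. real (w y) ^ 2) / (2 * real a) - (\<Sum>y<a. real (w y)) / 2 + (real a ^ 2 - 1) / 12"
proof -
  define B where "B y = (\<lambda>i. w y mod a + i * a) ` {..<w y div a}" for y
  define \<rho> where "\<rho> y = real (w y mod a)" for y
  have B: "B y = {n. n < w y \<and> n mod a = w y mod a}" for y
  proof (intro equalityI subsetI CollectI)
    fix n assume "n \<in> B y"
    then obtain i where i: "i < w y div a" "n = w y mod a + i * a" by (auto simp: B_def)
    have "i * a < w y div a * a" using i a by simp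
    then have "n < w y" using i div_mult_mod_eq [of "w y" a] by linarith
    then show "n < w y \<and> n mod a = w y mod a" using i by simp
  next
    fix n assume "n \<in> {n. n < w y \<and> n mod a = w y mod a}"
    then have n: "n < w y" "n mod a = w y mod a" by auto
    have "n div a < w y div a"
      using n a by (metis div_le_mono div_mult_mod_eq le_neq_implies_less less_imp_le less_irrefl)
    moreover have "n = w y mod a + n div a * a" using n by (metis mod_div_mult_eq)
    ultimately show "n \<in> B y" unfolding B_def by blast
  qed
  \<comment> \<open>The quotient \<open>w y div a\<close> is eliminated in favour of
    \<open>w y\<close> and the residue \<open>\<rho> y\<close>. Over all \<open>y\<close> the
    residues run through \<open>0, ..., a - 1\<close>, so their terms add up to the constant
    \<open>(a^2 - 1) / 12\<close>.\<close>
  have sumB: "real (\<Sum>(B y)) = (real (w y) ^ 2 - real a * real (w y)) / (2 * real a)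
      - \<rho> y ^ 2 / (2 * real a) + \<rho> y / 2" for y
  proof -
    have "inj_on (\<lambda>i. w y mod a + i * a) {..<w y div a}" using a by (auto intro: inj_onI)
    then have "real (\<Sum>(B y)) = (\<Sum>i<w y div a. \<rho> y + real i * real a)"
      unfolding B_def \<rho>_def by (simp add: sum.reindex)
    also have "\<dots> = real (w y div a) * \<rho> y
        + (real (w y div a) * (real (w y div a) - 1) / 2) * real a"
      by (simp add: sum.distrib real_sum_lessThan flip: sum_distrib_right)
    finally have 1: "real (\<Sum>(B y)) = \<dots>" .
    have 2: "real (w y) = real (w y div a) * real a + \<rho> y"
      unfolding \<rho>_def by (metis div_mult_mod_eq of_nat_add of_nat_mult)
    show ?thesis unfolding 1 2 using a by (simp add: field_simps power2_eq_square)
  qed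
  have img: "(\<lambda>y. w y mod a) ` {..<a} = {..<a}"
    by (rule endo_inj_surj) (use inj a in auto)
  have perm: "(\<Sum>y<a. f (w y mod a)) = (\<Sum>i<a. f i)" for f :: "nat \<Rightarrow> real"
    using sum.reindex [OF inj, of f] by (simp add: img)
  have \<rho>1: "(\<Sum>y<a. \<rho> y) = real a * (real a - 1) / 2"
    unfolding \<rho>_def perm [of real] by (rule real_sum_lessThan)
  have \<rho>2: "(\<Sum>y<a. \<rho> y ^ 2) = real a * (real a - 1) * (2 * real a - 1) / 6"
    unfolding \<rho>_def perm [of "\<lambda>i. real i ^ 2"] by (rule real_sum_squares_lessThan)
  have "{n. \<exists>y<a. n < w y \<and> n mod a = w y mod a} = (\<Union>y<a. B y)" by (auto simp: B)
  moreover have "\<Sum>(\<Union>y<a. B y) = (\<Sum>y<a. \<Sum>(B y))"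
  proof (rule sum.UNION_disjoint)
    show "\<forall>y\<in>{..<a}. finite (B y)" by (simp add: B_def)
    show "\<forall>y\<in>{..<a}. \<forall>z\<in>{..<a}. y \<noteq> z \<longrightarrow> B y \<inter> B z = {}"
    proof (intro ballI impI equals0I)
      fix y z n assume yz: "y \<in> {..<a}" "z \<in> {..<a}" "y \<noteq> z" and "n \<in> B y \<inter> B z"
      then have "w y mod a = w z mod a" unfolding B by simp
      with inj_onD [OF inj this yz(1,2)] yz(3) show False by blast
    qed
  qed simp
  ultimately have "real (\<Sum>{n. \<exists>y<a. n < w y \<and> n mod a = w y mod a}) = (\<Sum>y<a. real (\<Sum>(B y)))"
    by simp
  also have "\<dots> = ((\<Sum>y<a. real (w y) ^ 2) - real a * (\<Sum>y<a. real (w y))) / (2 * real a)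
      - (\<Sum>y<a. \<rho> y ^ 2) / (2 * real a) + (\<Sum>y<a. \<rho> y) / 2"
    unfolding sumB
    by (simp add: sum.distrib sum_subtractf sum_divide_distrib [symmetric] sum_distrib_left [symmetric])
  also have "\<dots> = (\<Sum>y<a. real (w y) ^ 2) / (2 * real a) - (\<Sum>y<a. real (w y)) / 2
      + (real a ^ 2 - 1) / 12"
    unfolding \<rho>1 \<rho>2 using a by (simp add: field_simps power2_eq_square)
  finally show ?thesis .
qed

text \<open>Reduces a closed form \<open>G q r\<close>, for \<open>q\<close> full blocks and
  \<open>r\<close> further terms after \<open>y = 0\<close>, to polynomial checks. Allowing
  \<open>r = K\<close> lets \<open>block\<close> glue the end of one block to the start of the
  next.\<close>

lemma sum_cdiv_blocks:
  fixes g :: "nat \<Rightarrow> nat \<Rightarrow> real" and G :: "nat \<Rightarrow> nat \<Rightarrow> real"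
  assumes "K > 0" "r \<le> K"
    and base: "G 0 0 = g 0 0"
    and block: "\<And>q. G (Suc q) 0 = G q K"
    and step: "\<And>q r. G q (Suc r) = G q r + g (Suc q) (Suc (q * K + r))"
  shows "(\<Sum>y<Suc (q * K + r). g (cdiv y K) y) = G q r"
  using assms(2)
proof (induction q arbitrary: r)
  case 0
  then show ?case
  proof (induction r)
    case 0
    have "cdiv 0 K = 0" using assms(1) by (simp add: cdiv_def)
    then show ?case by (simp add: base)
  next
    case (Suc r)
    then show ?case using cdiv_block [of r K 0] step [of 0 r] by simp
  qed
next
  case (Suc q)
  from Suc.prems show ?case
  proof (induction r)
    case 0
    \<comment> \<open>No term of the new block is present yet, so this is the previous block at
      \<open>r = K\<close>.\<close>
    show ?case using Suc.IH [of K] by (simp add: block add.commute)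
  next
    case (Suc r)
    then show ?case using cdiv_block [of r K "Suc q"] step [of "Suc q" r]
      by (simp del: mult_Suc)
  qed
qed

lemma sum_cdiv:
  assumes "K > 0" "r \<le> K"
  shows "(\<Sum>y<Suc (q * K + r). real (cdiv y K))
    = real K * real q * (real q + 1) / 2 + real r * (real q + 1)"
  by (rule sum_cdiv_blocks [OF assms, where g = "\<lambda>c y. real c"
        and G = "\<lambda>q r. real K * real q * (real q + 1) / 2 + real r * (real q + 1)"])
    (auto simp: field_simps)

lemma sum_cdiv_squares:
  assumes "K > 0" "r \<le> K"
  shows "(\<Sum>y<Suc (q * K + r). real (cdiv y K) ^ 2)
    = real K * real q * (real q + 1) * (2 * real q + 1) / 6 + real r * (real q + 1) ^ 2"
  by (rule sum_cdiv_blocks [OF assms, where g = "\<lambda>c y. real c ^ 2"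
        and G = "\<lambda>q r. real K * real q * (real q + 1) * (2 * real q + 1) / 6
                      + real r * (real q + 1) ^ 2"])
    (auto simp: field_simps power2_eq_square)

text \<open>The full block \<open>j < q\<close> contributes
  \<open>(j + 1) * (j * K^2 + K * (K + 1) / 2)\<close>; summing over \<open>j\<close> gives the
  first two terms, and the last one is the partial block.\<close>

lemma sum_cdiv_times:
  assumes "K > 0" "r \<le> K"
  shows "(\<Sum>y<Suc (q * K + r). real (cdiv y K) * real y)
    = real K ^ 2 * (real q - 1) * real q * (real q + 1) / 3
      + real K * (real K + 1) * real q * (real q + 1) / 4
      + (real q + 1) * (real r * real q * real K + real r * (real r + 1) / 2)"
  by (rule sum_cdiv_blocks [OF assms, where g = "\<lambda>c y. real c * real y"
        and G = "\<lambda>q r. real K ^ 2 * (real q - 1) * real q * (real q + 1) / 3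
            + real K * (real K + 1) * real q * (real q + 1) / 4
            + (real q + 1) * (real r * real q * real K + real r * (real r + 1) / 2)"])
    (auto simp: field_simps power2_eq_square)

lemma arith_prog_identity:
  fixes a d q r K :: real
  assumes "q \<noteq> 0" and a: "a = q * K + r + 1"
  shows "(a * (K * q * (q + 1) * (2 * q + 1) / 6 + r * (q + 1) ^ 2)
      + 2 * d * (K ^ 2 * (q - 1) * q * (q + 1) / 3 + K * (K + 1) * q * (q + 1) / 4
          + (q + 1) * (r * q * K + r * (r + 1) / 2))
      + d ^ 2 * ((a - 1) * (2 * a - 1) / 6)) / 2
    - (a * (K * q * (q + 1) / 2 + r * (q + 1)) + d * (a * (a - 1) / 2)) / 2 + (a ^ 2 - 1) / 12
    = 1 / (12 * q) * (2 * a * q ^ 3 * (a + 2 * r - 1)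
     + q ^ 2 * (a * d * (4 * a + 4 * r - 5) - d * (2 * r - 1) * (r + 1) + 6 * a * r)
     - q * (3 * d * r * (r + 1) - (a - 1) * ((a - 1) * (d ^ 2 - 1) + a * d ^ 2)
         - 2 * a * r * (3 * d + 1))
     - d * (q * K) ^ 2)"
    (is "?L = 1 / (12 * q) * ?R")
proof -
  \<comment> \<open>The factor 12 clears the numerical denominators on the left and \<open>q\<close>
    the one on the right. Only then is \<open>a\<close> substituted, leaving one polynomial identity
    in \<open>d\<close>, \<open>q\<close>, \<open>r\<close>, \<open>K\<close>.\<close>
  have "12 * ?L = a * (K * q * (q + 1) * (2 * q + 1) + 6 * r * (q + 1) ^ 2)
      + d * (4 * K ^ 2 * (q - 1) * q * (q + 1) + 3 * K * (K + 1) * q * (q + 1)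
          + (q + 1) * (12 * r * q * K + 6 * r * (r + 1)))
      + d ^ 2 * ((a - 1) * (2 * a - 1))
    - (a * (3 * K * q * (q + 1) + 6 * r * (q + 1)) + d * (3 * a * (a - 1))) + (a ^ 2 - 1)" (is "_ = ?X")
    by (simp add: field_simps power2_eq_square)
  then have "12 * q * ?L = q * ?X" by (simp only: ac_simps)
  also have "q * ?X = ?R" unfolding a by (simp add: algebra_simps power2_eq_square power3_eq_cube)
  finally have "12 * q * ?L = ?R" .
  moreover have "x = 1 / (12 * q) * y" if "12 * q * x = y" for x y
    using that assms(1) by (auto simp: field_simps)
  ultimately show ?thesis by blast
qed

theorem theorem1:
  fixes a d k q r :: nat
  assumes "a > 0" and "d > 0" and "k > 0"
    and "gcd a d = 1"
    and "2 \<le> k" and "k \<le> a"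
    and "a - 1 = q * (k - 1) + r" and "r < k - 1"
  shows "real (sylvester_sum (map (\<lambda>i. a + i * d) [0..<k])) =
    1 / (12 * real q) *
    (2 * real a * real q ^ 3 * (real a + 2 * real r - 1)
     + real q ^ 2 * (real a * real d * (4 * real a + 4 * real r - 5)
         - real d * (2 * real r - 1) * (real r + 1) + 6 * real a * real r)
     - real q * (3 * real d * real r * (real r + 1)
         - (real a - 1) * ((real a - 1) * (real d ^ 2 - 1) + real a * real d ^ 2)
         - 2 * real a * real r * (3 * real d + 1))
     - real d * (real a - real r - 1) ^ 2)"
proof -
  define K where "K = k - 1"
  have K: "K > 0" "k = Suc K" "r \<le> K" using assms by (auto simp: K_def)
  have aq: "a = Suc (q * K + r)" using assms by (simp add: K_def)
  have q: "q > 0"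
  proof (rule gr0I)
    \<comment> \<open>This would give \<open>a - 1 = r < k - 1\<close>, against
      \<open>k <= a\<close>.\<close>
    assume "q = 0"
    with assms show False by simp
  qed
  define w where "w y = a * cdiv y K + d * y" for y
  have "coprime a d" using assms(4) by (simp add: coprime_iff_gcd_eq_1)
  note NR = nonrepresentable_arith_prog [OF assms(1) K(1) this, folded w_def]
  define C1 where "C1 = (\<Sum>y<a. real (cdiv y K))"
  define C2 where "C2 = (\<Sum>y<a. real (cdiv y K) ^ 2)"
  define CY where "CY = (\<Sum>y<a. real (cdiv y K) * real y)"
  note C = sum_cdiv [OF K(1,3), of q, folded aq, folded C1_def]
    sum_cdiv_squares [OF K(1,3), of q, folded aq, folded C2_def]
    sum_cdiv_times [OF K(1,3), of q, folded aq, folded CY_def]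
  have w1: "(\<Sum>y<a. real (w y)) = real a * C1 + real d * (real a * (real a - 1) / 2)"
    unfolding w_def C1_def real_sum_lessThan [symmetric] sum_distrib_left
    by (simp add: sum.distrib)
  have w2: "(\<Sum>y<a. real (w y) ^ 2) = real a ^ 2 * C2 + 2 * real a * real d * CY
      + real d ^ 2 * (real a * (real a - 1) * (2 * real a - 1) / 6)"
    unfolding w_def C2_def CY_def real_sum_squares_lessThan [symmetric] sum_distrib_left
      sum.distrib [symmetric]
    by (rule sum.cong) (simp_all add: power2_eq_square algebra_simps)
  have "real (sylvester_sum (map (\<lambda>i. a + i * d) [0..<k]))
      = (\<Sum>y<a. real (w y) ^ 2) / (2 * real a) - (\<Sum>y<a. real (w y)) / 2 + (real a ^ 2 - 1) / 12"
    unfolding sylvester_sum_def K(2) NR(2) by (rule sum_below_Apery [OF assms(1) NR(1)])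
  \<comment> \<open>Every term of \<open>w2\<close> contains a factor \<open>a\<close>, which
    cancels against \<open>2 * a\<close>; the result is the left side of
    \<open>arith_prog_identity\<close>.\<close>
  also have "\<dots> = (real a * C2 + 2 * real d * CY
        + real d ^ 2 * ((real a - 1) * (2 * real a - 1) / 6)) / 2
      - (real a * C1 + real d * (real a * (real a - 1) / 2)) / 2 + (real a ^ 2 - 1) / 12"
    unfolding w1 w2 using assms(1) by (simp add: field_simps power2_eq_square)
  finally have s: "real (sylvester_sum (map (\<lambda>i. a + i * d) [0..<k])) = \<dots>" .
  have ra: "real a = real q * real K + real r + 1" unfolding aq by simp
  have rK: "real a - real r - 1 = real q * real K" by (simp add: ra)
  show ?thesis
    unfolding s C rK by (rule arith_prog_identity [OF _ ra]) (use q in simp)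
qed

end
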